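(* Let $S=\bigoplus_{i\ge0}S_i$ be a Noetherian graded integral domain, let $\mathcal{F}=\{I_i\}_{i\ge1}$ be a graded family of homogeneous ideals of $S$, and let $\nu$ be an $S$-valuation. Suppose the Rees algebra $\mathcal{R}(\mathcal{F})$ is generated as an $S$-algebra by $\{f_1T^{n_1},\dots,f_kT^{n_k}\}$, where $f_1,\dots,f_k$ are nonzero homogeneous elements of $S$ and $n_1,\dots,n_k\ge1$ are integers (not necessarily distinct). Let $\mathcal{U}=\{n_1,\dots,n_k\}$, assume $1\in\mathcal{U}$, and define $d$ on $\mathcal{U}$ by $d_i=\min\{\nu(f_j) : 1\le j\le k,\ n_j=i\}$ for $i\in\mathcal{U}$. Then for every integer $s\ge1$, \[ \nu(I_s)=\min\Big\{\sum_{i\in\mathcal{U}}d_ib_i : b_i\in\mathbb{Z}_{\ge0}\text{ for all }i\in\mathcal{U}\text{ and }\sum_{i\in\mathcal{U}}ib_i=s\Big\}. \] It follows that (a) for $s\in\mathcal{U}$, $\nu(I_s)=d_s$ if and only if $d_s$ is a subadditive term of $d$; (b) $\widehat{\nu}(\mathcal{F})=\min\left\{\frac{d_i}{i} : i\in\mathcal{U}\right\}=\min\left\{\frac{d_i}{i} : i\in\mathcal{U},\ d_i\text{ is a strictly subadditive term of }d\right\}$.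
   Context: A graded family of ideals satisfies $I_iI_j\subseteq I_{i+j}$ for all $i,j\ge1$, with $I_0=S$. Its Rees algebra is $\mathcal{R}(\mathcal{F})=\bigoplus_{i\ge0}I_iT^i\subseteq S[T]$, $T$ an indeterminate. Let $K$ be the fraction field of $S$. A discrete valuation is a function $\nu:K\setminus\{0\}\to\mathbb{Z}$ with $\nu(fg)=\nu(f)+\nu(g)$ and $\nu(f+g)\ge\min\{\nu(f),\nu(g)\}$ (when $f+g\neq0$); it is an $S$-valuation if it is non-negative on $S\setminus\{0\}$. For a nonzero ideal $J\subseteq S$, $\nu(J)=\min\{\nu(f): f\in J\setminus\{0\}\}$. Define $\widehat{\nu}(\mathcal{F})=\lim_{s\to\infty}\nu(I_s)/s$ (the limit exists). For $s\in\mathcal{U}$, $d_s$ is a subadditive term of $d$ if $d_s\le\sum_{i=1}^m d_{a_i}$ for all $m\ge1$ and all (not necessarily distinct) $a_1,\dots,a_m\in\mathcal{U}$ with $\sum a_i=s$; it is a strictly subadditive term if $d_s<\sum_{i=1}^m d_{a_i}$ for all $m\ge2$ and all (not necessarily distinct) $a_1,\dots,a_m\in\mathcal{U}$ with $\sum a_i=s$. The term $d_1$ is by convention always both subadditive and strictly subadditive. *)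

theory Defs
  imports Complex_Main "HOL-Computational_Algebra.Polynomial_Factorial"
begin

text \<open>
  The ring \<open>S\<close> is a type \<open>'a\<close> (of class \<open>idom\<close>), its fraction field \<open>K\<close> is \<open>'a fract\<close> and
  \<open>S[T]\<close> is \<open>'a poly\<close>.  The ideals of a commutative ring are the submodules of the ring regarded
  as a module over itself.
\<close>

lemma module_times: "module ((*) :: 'a::comm_ring_1 \<Rightarrow> 'a \<Rightarrow> 'a)"
  by unfold_locales (simp_all add: algebra_simps)

abbreviation ring_ideal :: "'a::comm_ring_1 set \<Rightarrow> bool"
  where "ring_ideal \<equiv> module.subspace (*)"

abbreviation ideal_generated :: "'a::comm_ring_1 set \<Rightarrow> 'a set"
  where "ideal_generated \<equiv> module.span (*)"

definition ideal_mult :: "'a::comm_ring_1 set \<Rightarrow> 'a set \<Rightarrow> 'a set"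
  where "ideal_mult I J = ideal_generated {x * y | x y. x \<in> I \<and> y \<in> J}"

definition noetherian :: "'a::comm_ring_1 itself \<Rightarrow> bool"
  where "noetherian _ \<longleftrightarrow>
    (\<forall>J :: 'a set. ring_ideal J \<longrightarrow> (\<exists>B. finite B \<and> J = ideal_generated B))"

text \<open>The direct sum condition is the unique decomposition of elements into finitely many
  nonzero homogeneous components.\<close>

definition is_grading :: "(nat \<Rightarrow> 'a::comm_ring_1 set) \<Rightarrow> bool"
  where "is_grading G \<longleftrightarrow>
    (\<forall>i. 0 \<in> G i \<and> (\<forall>x\<in>G i. \<forall>y\<in>G i. x + y \<in> G i) \<and> (\<forall>x\<in>G i. - x \<in> G i)) \<and>
    (\<forall>i j. \<forall>x\<in>G i. \<forall>y\<in>G j. x * y \<in> G (i + j)) \<and>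
    (\<forall>x. \<exists>!c. (\<forall>i. c i \<in> G i) \<and> finite {i. c i \<noteq> 0} \<and> x = (\<Sum>i | c i \<noteq> 0. c i))"

definition homogeneous :: "(nat \<Rightarrow> 'a::comm_ring_1 set) \<Rightarrow> 'a \<Rightarrow> bool"
  where "homogeneous G x \<longleftrightarrow> (\<exists>i. x \<in> G i)"

definition homogeneous_ideal :: "(nat \<Rightarrow> 'a::comm_ring_1 set) \<Rightarrow> 'a set \<Rightarrow> bool"
  where "homogeneous_ideal G J \<longleftrightarrow>
    ring_ideal J \<and> J = ideal_generated {x \<in> J. homogeneous G x}"

text \<open>A graded family is indexed by the positive integers; the value at \<open>0\<close> is fixed to be the
  whole ring.\<close>

definition graded_family :: "(nat \<Rightarrow> 'a::comm_ring_1 set) \<Rightarrow> bool"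
  where "graded_family I \<longleftrightarrow>
    I 0 = UNIV \<and> (\<forall>i\<ge>1. ring_ideal (I i)) \<and>
    (\<forall>i\<ge>1. \<forall>j\<ge>1. ideal_mult (I i) (I j) \<subseteq> I (i + j))"

definition rees_algebra :: "(nat \<Rightarrow> 'a::comm_ring_1 set) \<Rightarrow> 'a poly set"
  where "rees_algebra I = {p. \<forall>i. coeff p i \<in> I i}"

definition poly_subalgebra :: "'a::comm_ring_1 poly set \<Rightarrow> bool"
  where "poly_subalgebra A \<longleftrightarrow>
    1 \<in> A \<and> (\<forall>p\<in>A. \<forall>q\<in>A. p + q \<in> A) \<and> (\<forall>p\<in>A. \<forall>q\<in>A. p * q \<in> A) \<and>
    (\<forall>c. \<forall>p\<in>A. smult c p \<in> A)"

text \<open>A valuation is a function on \<open>K - {0}\<close>, so its value at \<open>0\<close> is left arbitrary and never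
  used.\<close>

definition discrete_valuation :: "('k::field \<Rightarrow> int) \<Rightarrow> bool"
  where "discrete_valuation \<nu> \<longleftrightarrow>
    (\<forall>f g. f \<noteq> 0 \<longrightarrow> g \<noteq> 0 \<longrightarrow> \<nu> (f * g) = \<nu> f + \<nu> g) \<and>
    (\<forall>f g. f \<noteq> 0 \<longrightarrow> g \<noteq> 0 \<longrightarrow> f + g \<noteq> 0 \<longrightarrow> min (\<nu> f) (\<nu> g) \<le> \<nu> (f + g))"

definition S_valuation :: "('a::idom fract \<Rightarrow> int) \<Rightarrow> bool"
  where "S_valuation \<nu> \<longleftrightarrow> discrete_valuation \<nu> \<and> (\<forall>x. x \<noteq> 0 \<longrightarrow> 0 \<le> \<nu> (to_fract x))"

text \<open>\<open>LEAST\<close> and not \<open>Min\<close>, because the set of values on an ideal may be infinite.\<close>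

definition ideal_val :: "('a::idom fract \<Rightarrow> int) \<Rightarrow> 'a set \<Rightarrow> int"
  where "ideal_val \<nu> J = (LEAST m. m \<in> (\<lambda>x. \<nu> (to_fract x)) ` (J - {0}))"

lemma ideal_val_attained:
  assumes "S_valuation \<nu>" "J - {0} \<noteq> {}"
  shows "ideal_val \<nu> J \<in> (\<lambda>x. \<nu> (to_fract x)) ` (J - {0})"
    and "\<And>x. x \<in> J \<Longrightarrow> x \<noteq> 0 \<Longrightarrow> ideal_val \<nu> J \<le> \<nu> (to_fract x)"
proof -
  let ?V = "(\<lambda>x. \<nu> (to_fract x)) ` (J - {0})"
  have nonneg: "0 \<le> v" if "v \<in> ?V" for v
    using assms(1) that by (auto simp: S_valuation_def)
  from assms(2) obtain v where "v \<in> ?V" by blast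
  with nonneg have "int (nat v) \<in> ?V" by auto
  then have least: "int (LEAST n. int n \<in> ?V) \<in> ?V" by (rule LeastI)
  have le: "int (LEAST n. int n \<in> ?V) \<le> w" if "w \<in> ?V" for w
  proof -
    from nonneg[OF that] that have "int (nat w) \<in> ?V" by simp
    then have "(LEAST n. int n \<in> ?V) \<le> nat w" by (rule Least_le)
    with nonneg[OF that] show ?thesis by linarith
  qed
  have eq: "ideal_val \<nu> J = int (LEAST n. int n \<in> ?V)"
    unfolding ideal_val_def by (rule Least_equality) (use least le in auto)
  show "ideal_val \<nu> J \<in> ?V" unfolding eq by (rule least)
  show "ideal_val \<nu> J \<le> \<nu> (to_fract x)" if "x \<in> J" "x \<noteq> 0" for x
    unfolding eq by (rule le) (use that in auto)
qed

definition asymptotic_val :: "('a::idom fract \<Rightarrow> int) \<Rightarrow> (nat \<Rightarrow> 'a set) \<Rightarrow> real"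
  where "asymptotic_val \<nu> I = lim (\<lambda>s. real_of_int (ideal_val \<nu> (I s)) / real s)"

text \<open>The tuples \<open>(a\<^sub>1, \<dots>, a\<^sub>m)\<close> are lists of length \<open>m\<close>.\<close>

definition subadditive_term :: "nat set \<Rightarrow> (nat \<Rightarrow> int) \<Rightarrow> nat \<Rightarrow> bool"
  where "subadditive_term U d s \<longleftrightarrow>
    s = 1 \<or>
    (\<forall>as. length as \<ge> 1 \<longrightarrow> set as \<subseteq> U \<longrightarrow> sum_list as = s \<longrightarrow> d s \<le> (\<Sum>a\<leftarrow>as. d a))"

definition strictly_subadditive_term :: "nat set \<Rightarrow> (nat \<Rightarrow> int) \<Rightarrow> nat \<Rightarrow> bool"
  where "strictly_subadditive_term U d s \<longleftrightarrow>
    s = 1 \<or>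
    (\<forall>as. length as \<ge> 2 \<longrightarrow> set as \<subseteq> U \<longrightarrow> sum_list as = s \<longrightarrow> d s < (\<Sum>a\<leftarrow>as. d a))"

end

theory Submission
  imports Defs
begin

text \<open>
  The algebra generators \<open>f\<^sub>j T\<^bsup>n\<^sub>j\<^esup>\<close> of least value in each degree show that \<open>I\<^sub>s\<close> contains elements
  of value \<open>d\<^sub>a\<^sub>1 + \<dots> + d\<^sub>a\<^sub>m\<close> whenever \<open>s = a\<^sub>1 + \<dots> + a\<^sub>m\<close> with all \<open>a\<^sub>i\<close> in \<open>U\<close>.  Conversely,
  let \<open>M s\<close> be the least such sum.  Since \<open>M\<close> is subadditive, the polynomials whose \<open>s\<close>-th
  coefficient has value at least \<open>M s\<close>, for every \<open>s\<close>, form a subalgebra; it contains the generators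
  and hence the Rees algebra.  If \<open>\<alpha> = d\<^sub>i / i\<close> is the least slope, then \<open>M s\<close> lies between \<open>\<alpha> s\<close> and
  \<open>\<alpha> s\<close> plus a constant, because \<open>s\<close> is a sum of copies of \<open>i\<close> and fewer than \<open>i\<close> copies of \<open>1\<close>.
  The smallest \<open>i\<close> of least slope is a strictly subadditive term, as all its proper parts have
  larger slope.
\<close>

section \<open>Sums of \<open>d\<close> over decompositions of an integer\<close>

definition decomposition_sums :: "nat set \<Rightarrow> (nat \<Rightarrow> int) \<Rightarrow> nat \<Rightarrow> int set"
  where "decomposition_sums U d s = {(\<Sum>a\<leftarrow>as. d a) | as. set as \<subseteq> U \<and> sum_list as = s}"

lemma list_of_multiplicities:
  fixes b :: "nat \<Rightarrow> nat" and d :: "nat \<Rightarrow> int"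
  assumes "finite U"
  shows "\<exists>as. set as \<subseteq> U \<and> sum_list as = (\<Sum>i\<in>U. i * b i) \<and>
    (\<Sum>a\<leftarrow>as. d a) = (\<Sum>i\<in>U. d i * int (b i))"
  using assms
proof (induction U)
  case empty
  show ?case by (rule exI[of _ "[]"]) simp
next
  case (insert x F)
  then obtain as where "set as \<subseteq> F" "sum_list as = (\<Sum>i\<in>F. i * b i)"
    "(\<Sum>a\<leftarrow>as. d a) = (\<Sum>i\<in>F. d i * int (b i))" by blast
  with insert.hyps show ?case
    by (intro exI[of _ "replicate (b x) x @ as"]) (auto simp: sum_list_replicate)
qed

lemma multiplicities_of_list:
  fixes d :: "nat \<Rightarrow> int"
  assumes "finite U" "set as \<subseteq> U"
  shows "(\<Sum>i\<in>U. i * count_list as i) = sum_list as \<and>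
    (\<Sum>i\<in>U. d i * int (count_list as i)) = (\<Sum>a\<leftarrow>as. d a)"
  using assms(2)
proof (induction as)
  case Nil
  show ?case by simp
next
  case (Cons a as)
  \<comment> \<open>Prepending \<open>a\<close> changes only the summand at \<open>i = a\<close>;
    the \<open>if\<close> isolates this change so that \<open>sum.distrib\<close> splits it
    off.\<close>
  have 1: "(\<Sum>i\<in>U. i * count_list (a # as) i) =
    (\<Sum>i\<in>U. (if i = a then a else 0) + i * count_list as i)"
    by (rule sum.cong) auto
  have 2: "(\<Sum>i\<in>U. d i * int (count_list (a # as) i)) =
    (\<Sum>i\<in>U. (if i = a then d a else 0) + d i * int (count_list as i))"
    by (rule sum.cong) (auto simp: algebra_simps)
  show ?case
    unfolding 1 2 using Cons assms(1) by (simp add: sum.distrib)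
qed

text \<open>Lists and multiplicity functions describe the same multisets in \<open>U\<close>:
  \<open>count_list\<close> leads one way, concatenated constant blocks the other. This links the
  formula for \<nu> on \<open>I s\<close> to the tuples of subadditivity.\<close>

lemma decomposition_sums_eq_multiplicities:
  assumes "finite U"
  shows "decomposition_sums U d s =
    {(\<Sum>i\<in>U. d i * int (b i)) | b :: nat \<Rightarrow> nat. (\<Sum>i\<in>U. i * b i) = s}" (is "_ = ?B")
proof (intro equalityI subsetI)
  fix v assume "v \<in> decomposition_sums U d s"
  then obtain as where "set as \<subseteq> U" "sum_list as = s" "v = (\<Sum>a\<leftarrow>as. d a)"
    unfolding decomposition_sums_def by blast
  with multiplicities_of_list[OF assms, of as d] show "v \<in> ?B"
    by (auto intro!: exI[of _ "count_list as"])
next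
  fix v assume "v \<in> ?B"
  then obtain b :: "nat \<Rightarrow> nat" where "(\<Sum>i\<in>U. i * b i) = s" "v = (\<Sum>i\<in>U. d i * int (b i))"
    by blast
  moreover from list_of_multiplicities[OF assms, of b d] obtain as where "set as \<subseteq> U"
    "sum_list as = (\<Sum>i\<in>U. i * b i)" "(\<Sum>a\<leftarrow>as. d a) = (\<Sum>i\<in>U. d i * int (b i))" by blast
  ultimately show "v \<in> decomposition_sums U d s"
    unfolding decomposition_sums_def by (intro CollectI exI[of _ as]) simp
qed

lemma length_le_sum_list:
  fixes as :: "nat list"
  assumes "0 \<notin> set as"
  shows "length as \<le> sum_list as"
  using assms by (induction as) auto

text \<open>Positive entries bound the length of a list by its sum, so only finitely many lists
  occur.\<close>

lemma finite_decomposition_sums: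
  assumes "finite U" "0 \<notin> U"
  shows "finite (decomposition_sums U d s)"
proof -
  have "decomposition_sums U d s \<subseteq> (\<lambda>as. \<Sum>a\<leftarrow>as. d a) ` {as. set as \<subseteq> U \<and> length as \<le> s}"
    unfolding decomposition_sums_def using assms(2) length_le_sum_list by fast
  then show ?thesis
    by (rule finite_subset) (intro finite_imageI finite_lists_length_le assms)
qed

lemma decomposition_sums_nonempty:
  assumes "1 \<in> U"
  shows "decomposition_sums U d s \<noteq> {}"
proof -
  have "(\<Sum>a\<leftarrow>replicate s 1. d a) \<in> decomposition_sums U d s"
    unfolding decomposition_sums_def using assms
    by (intro CollectI exI[of _ "replicate s 1"]) (auto simp: sum_list_replicate)
  then show ?thesis by blast
qed

text \<open>Concatenation of decompositions; this makes the least sum subadditive in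
  \<open>s\<close>.\<close>

lemma add_in_decomposition_sums:
  assumes "v \<in> decomposition_sums U d s" "w \<in> decomposition_sums U d t"
  shows "v + w \<in> decomposition_sums U d (s + t)"
proof -
  from assms obtain as bs where "set as \<subseteq> U" "sum_list as = s" "v = (\<Sum>a\<leftarrow>as. d a)"
    "set bs \<subseteq> U" "sum_list bs = t" "w = (\<Sum>a\<leftarrow>bs. d a)"
    unfolding decomposition_sums_def by blast
  then show ?thesis
    unfolding decomposition_sums_def by (intro CollectI exI[of _ "as @ bs"]) auto
qed

lemma generator_in_decomposition_sums:
  assumes "i \<in> U"
  shows "d i \<in> decomposition_sums U d i"
  unfolding decomposition_sums_def using assms by (intro CollectI exI[of _ "[i]"]) auto

text \<open>As \<open>d s\<close> is itself one of the sums, it is their minimum iff it is a lower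
  bound for them.\<close>

lemma Min_decomposition_sums_eq_iff_subadditive:
  assumes "finite U" "0 \<notin> U" "s \<in> U"
  shows "Min (decomposition_sums U d s) = d s \<longleftrightarrow> subadditive_term U d s"
proof -
  have "Min (decomposition_sums U d s) = d s \<longleftrightarrow> (\<forall>v\<in>decomposition_sums U d s. d s \<le> v)"
    using finite_decomposition_sums[OF assms(1,2)] generator_in_decomposition_sums[OF assms(3)]
    by (metis Min_eqI Min_le)
  also have "\<dots> \<longleftrightarrow> subadditive_term U d s"
  proof (cases "s = 1")
    case True
    \<comment> \<open>The convention for 1 agrees with the inequality, because \<open>[1]\<close> is
      the only decomposition of 1.\<close>
    have "as = [1]" if "set as \<subseteq> U" "sum_list as = 1" for as
    proof -
      from that assms(2) have "length as \<le> 1" using length_le_sum_list[of as] by auto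
      with that show ?thesis by (cases as) auto
    qed
    with True show ?thesis
      unfolding subadditive_term_def decomposition_sums_def by fastforce
  next
    case False
    \<comment> \<open>As \<open>s > 0\<close>, its decompositions are nonempty, so both sides
      quantify over the same lists.\<close>
    have "length as \<ge> 1" if "sum_list as = s" for as
      using that assms by (cases as) auto
    with False show ?thesis
      unfolding subadditive_term_def decomposition_sums_def by blast
  qed
  finally show ?thesis .
qed

section \<open>Least slope and growth of the least sum\<close>

lemma sum_list_slope_le:
  fixes \<alpha> :: real and d :: "nat \<Rightarrow> int"
  assumes "\<And>i. i \<in> set as \<Longrightarrow> \<alpha> * real i \<le> real_of_int (d i)"
  shows "\<alpha> * real (sum_list as) \<le> real_of_int (\<Sum>a\<leftarrow>as. d a)"
  using assms by (induction as) (auto simp: algebra_simps intro: add_mono)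

lemma sum_list_slope_less:
  fixes \<alpha> :: real and d :: "nat \<Rightarrow> int"
  assumes "as \<noteq> []" "\<And>i. i \<in> set as \<Longrightarrow> \<alpha> * real i < real_of_int (d i)"
  shows "\<alpha> * real (sum_list as) < real_of_int (\<Sum>a\<leftarrow>as. d a)"
  using assms
proof (induction as rule: list_nonempty_induct)
  case (cons a as)
  then have "\<alpha> * real (sum_list as) < real_of_int (\<Sum>a\<leftarrow>as. d a)" "\<alpha> * real a < real_of_int (d a)"
    by auto
  then show ?case by (simp add: algebra_simps)
qed simp

lemma Min_decomposition_sums_slope_bounds:
  fixes d :: "nat \<Rightarrow> int"
  assumes "finite U" "0 \<notin> U" "1 \<in> U" "i \<in> U" "\<And>j. j \<in> U \<Longrightarrow> 0 \<le> d j"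
    and slope: "\<And>j. j \<in> U \<Longrightarrow> real_of_int (d i) / real i \<le> real_of_int (d j) / real j"
  shows "real_of_int (d i) / real i * real s \<le> real_of_int (Min (decomposition_sums U d s))"
    and "real_of_int (Min (decomposition_sums U d s))
      \<le> real_of_int (d i) / real i * real s + real i * real_of_int (d 1)"
proof -
  let ?\<alpha> = "real_of_int (d i) / real i"
  note fin = finite_decomposition_sums[OF assms(1,2), of d s]
  have pos: "j > 0" if "j \<in> U" for j using that assms(2) by (cases j) auto
  have "Min (decomposition_sums U d s) \<in> decomposition_sums U d s"
    using fin decomposition_sums_nonempty[OF assms(3)] by (rule Min_in)
  then obtain as where as: "set as \<subseteq> U" "sum_list as = s"
    "Min (decomposition_sums U d s) = (\<Sum>a\<leftarrow>as. d a)"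
    unfolding decomposition_sums_def by blast
  have "?\<alpha> * real j \<le> real_of_int (d j)" if "j \<in> U" for j
    using slope[OF that] pos[OF that] by (simp add: pos_le_divide_eq)
  with as(1) have "?\<alpha> * real (sum_list as) \<le> real_of_int (\<Sum>a\<leftarrow>as. d a)"
    by (intro sum_list_slope_le) auto
  then show "?\<alpha> * real s \<le> real_of_int (Min (decomposition_sums U d s))"
    unfolding as(2,3) .
  \<comment> \<open>Division of \<open>s\<close> by \<open>i\<close> with remainder; the remainder
    is filled up with ones.\<close>
  let ?bs = "replicate (s div i) i @ replicate (s mod i) 1"
  have "(\<Sum>a\<leftarrow>?bs. d a) \<in> decomposition_sums U d s"
    unfolding decomposition_sums_def using assms(3,4)
    by (intro CollectI exI[of _ ?bs]) (auto simp: sum_list_replicate)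
  then have "Min (decomposition_sums U d s) \<le> (\<Sum>a\<leftarrow>?bs. d a)"
    using fin by simp
  then have "real_of_int (Min (decomposition_sums U d s)) \<le> real_of_int (\<Sum>a\<leftarrow>?bs. d a)"
    by (simp only: of_int_le_iff)
  also have "\<dots> = ?\<alpha> * real (i * (s div i)) + real (s mod i) * real_of_int (d 1)"
    using pos[OF assms(4)] by (simp add: sum_list_replicate)
  \<comment> \<open>Here \<open>i * (s div i) \<le> s\<close> and \<open>s mod i < i\<close>; the
    factors \<open>?\<alpha>\<close> and \<open>d 1\<close> are nonnegative.\<close>
  also have "\<dots> \<le> ?\<alpha> * real s + real i * real_of_int (d 1)"
    using assms(3-5) pos[OF assms(4)]
    by (intro add_mono mult_left_mono mult_right_mono)
       (auto simp: less_imp_le simp flip: of_nat_mult)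
  finally show "real_of_int (Min (decomposition_sums U d s))
      \<le> ?\<alpha> * real s + real i * real_of_int (d 1)" .
qed

text \<open>The gap between the two bounds is constant in \<open>s\<close>, so it vanishes after
  division by \<open>s\<close>.\<close>

lemma Min_decomposition_sums_slope_limit:
  fixes d :: "nat \<Rightarrow> int"
  assumes "finite U" "0 \<notin> U" "1 \<in> U" "i \<in> U" "\<And>j. j \<in> U \<Longrightarrow> 0 \<le> d j"
    and "\<And>j. j \<in> U \<Longrightarrow> real_of_int (d i) / real i \<le> real_of_int (d j) / real j"
  shows "(\<lambda>s. real_of_int (Min (decomposition_sums U d s)) / real s)
    \<longlonglongrightarrow> real_of_int (d i) / real i"
proof (rule tendsto_sandwich)
  let ?\<alpha> = "real_of_int (d i) / real i"
  let ?C = "real i * real_of_int (d 1)"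
  note bounds = Min_decomposition_sums_slope_bounds[of U i d, OF assms]
  show "\<forall>\<^sub>F s in sequentially. ?\<alpha> \<le> real_of_int (Min (decomposition_sums U d s)) / real s"
    using eventually_gt_at_top[of 0] by eventually_elim (use bounds(1) in \<open>simp add: pos_le_divide_eq\<close>)
  show "\<forall>\<^sub>F s in sequentially.
      real_of_int (Min (decomposition_sums U d s)) / real s \<le> ?\<alpha> + ?C / real s"
    using eventually_gt_at_top[of 0]
  proof eventually_elim
    case (elim s)
    with bounds(2)[of s] have "real_of_int (Min (decomposition_sums U d s)) / real s
      \<le> (?\<alpha> * real s + ?C) / real s" by (intro divide_right_mono) auto
    with elim show ?case by (simp add: add_divide_distrib)
  qed
  have "(\<lambda>s. ?\<alpha> + ?C / real s) \<longlonglongrightarrow> ?\<alpha> + 0"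
    by (intro tendsto_intros lim_const_over_n)
  then show "(\<lambda>s. ?\<alpha> + ?C / real s) \<longlonglongrightarrow> ?\<alpha>" by simp
qed simp

text \<open>For a decomposition of \<open>i\<close>, the sum of \<open>d\<close> divided by
  \<open>i\<close> is a weighted average of the slopes of the parts, hence exceeds the slope of
  \<open>i\<close> once each part does.\<close>

lemma minimal_slope_strictly_subadditive:
  fixes d :: "nat \<Rightarrow> int"
  assumes "finite U" "U \<noteq> {}" "0 \<notin> U"
  obtains i where "i \<in> U" "strictly_subadditive_term U d i"
    "\<And>j. j \<in> U \<Longrightarrow> real_of_int (d i) / real i \<le> real_of_int (d j) / real j"
proof -
  define slope where "slope j = real_of_int (d j) / real j" for j
  let ?P = "\<lambda>i. i \<in> U \<and> (\<forall>j\<in>U. slope i \<le> slope j)"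
  have pos: "j > 0" if "j \<in> U" for j using that assms(3) by (cases j) auto
  have "\<exists>i. ?P i"
    using ex_min_if_finite[of "slope ` U"] assms(1,2) by (fastforce simp: not_less)
  then obtain i where i: "i \<in> U" "\<And>j. j \<in> U \<Longrightarrow> slope i \<le> slope j"
    and least: "\<And>j. j < i \<Longrightarrow> \<not> ?P j"
    using exists_least_iff[of ?P] by blast
  have "d i < (\<Sum>a\<leftarrow>as. d a)" if as: "length as \<ge> 2" "set as \<subseteq> U" "sum_list as = i" for as
  proof -
    have "slope i * real j < real_of_int (d j)" if j: "j \<in> set as" for j
    proof -
      from j as(2) have "j \<in> U" by blast
      \<comment> \<open>What remains beside the part \<open>j\<close> is a nonempty list of positive
        numbers, so \<open>j < i\<close>.\<close>
      from j obtain xs ys where split: "as = xs @ j # ys" by (auto dest: split_list)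
      with as have "length (xs @ ys) \<ge> 1" "0 \<notin> set (xs @ ys)" using assms(3) by auto
      then have "sum_list (xs @ ys) \<ge> 1" using length_le_sum_list[of "xs @ ys"] by linarith
      with split as(3) have "j < i" by simp
      have "slope i < slope j"
      proof (rule ccontr)
        \<comment> \<open>Then \<open>j\<close> would be a smaller index of least slope, against the
          choice of \<open>i\<close>.\<close>
        assume "\<not> slope i < slope j"
        with i(2) have "\<forall>l\<in>U. slope j \<le> slope l" by force
        with least[OF \<open>j < i\<close>] \<open>j \<in> U\<close> show False by blast
      qed
      with pos[OF \<open>j \<in> U\<close>] show ?thesis by (simp add: slope_def[of j] pos_less_divide_eq)
    qed
    with as have "slope i * real i < real_of_int (\<Sum>a\<leftarrow>as. d a)"
      using sum_list_slope_less[of as "slope i" d] by force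
    with pos[OF i(1)] have "real_of_int (d i) < real_of_int (\<Sum>a\<leftarrow>as. d a)"
      by (simp add: slope_def)
    then show ?thesis by (simp only: of_int_less_iff)
  qed
  with i that show ?thesis unfolding strictly_subadditive_term_def slope_def by blast
qed

section \<open>Subalgebras of S[T] cut out by value bounds\<close>

text \<open>The disjunct \<open>x = 0\<close> encodes the convention that 0 has infinite value, as
  \<nu> is arbitrary there. It makes the condition stable under sums that cancel.\<close>

definition value_at_least :: "('a::idom fract \<Rightarrow> int) \<Rightarrow> int \<Rightarrow> 'a \<Rightarrow> bool"
  where "value_at_least \<nu> m x \<longleftrightarrow> x = 0 \<or> m \<le> \<nu> (to_fract x)"

lemma S_valuation_mult:
  assumes "S_valuation \<nu>" "x \<noteq> 0" "y \<noteq> 0"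
  shows "\<nu> (to_fract (x * y)) = \<nu> (to_fract x) + \<nu> (to_fract y)"
  using assms unfolding S_valuation_def discrete_valuation_def by simp

lemma S_valuation_one:
  assumes "S_valuation \<nu>"
  shows "\<nu> (to_fract 1) = 0"
  using S_valuation_mult[OF assms, of 1 1] by simp

lemma value_at_least_add:
  assumes "S_valuation \<nu>" "value_at_least \<nu> m x" "value_at_least \<nu> m y"
  shows "value_at_least \<nu> m (x + y)"
proof (cases "x = 0 \<or> y = 0 \<or> x + y = 0")
  case True
  with assms show ?thesis by (auto simp: value_at_least_def)
next
  case False
  then have "to_fract x + to_fract y \<noteq> 0"
    by (simp flip: to_fract_add)
  with False assms(1) have "min (\<nu> (to_fract x)) (\<nu> (to_fract y)) \<le> \<nu> (to_fract x + to_fract y)"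
    unfolding S_valuation_def discrete_valuation_def by simp
  with False assms show ?thesis by (auto simp: value_at_least_def)
qed

lemma value_at_least_sum:
  assumes "S_valuation \<nu>" "\<And>i. i \<in> A \<Longrightarrow> value_at_least \<nu> m (g i)"
  shows "value_at_least \<nu> m (sum g A)"
  using assms(2)
  by (induction A rule: infinite_finite_induct)
     (auto intro: value_at_least_add[OF assms(1)] simp: value_at_least_def[of \<nu> m 0])

lemma value_at_least_mult:
  assumes "S_valuation \<nu>" "value_at_least \<nu> l x" "value_at_least \<nu> m y"
  shows "value_at_least \<nu> (l + m) (x * y)"
  using assms S_valuation_mult[OF assms(1), of x y]
  by (cases "x = 0 \<or> y = 0") (auto simp: value_at_least_def)

lemma value_at_least_antimono:
  assumes "value_at_least \<nu> m x" "l \<le> m"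
  shows "value_at_least \<nu> l x"
  using assms by (auto simp: value_at_least_def)

text \<open>Intersections of subalgebras are subalgebras, so the hull is the generated
  subalgebra.\<close>

lemma poly_subalgebra_hull: "poly_subalgebra (poly_subalgebra hull A)"
  by (rule hull_in) (simp add: poly_subalgebra_def)

text \<open>\<open>M 0 \<le> 0\<close> admits the constant 1, and nonnegativity of \<nu> on S admits
  scalars. For products, each term of the convolution has value at least
  \<open>M l + M (i - l)\<close>, hence at least \<open>M i\<close>.\<close>

lemma poly_subalgebra_value_at_least:
  assumes "S_valuation \<nu>" "M 0 \<le> 0" "\<And>i j. M (i + j) \<le> M i + M j"
  shows "poly_subalgebra {p. \<forall>i. value_at_least \<nu> (M i) (coeff p i)}"
  unfolding poly_subalgebra_def
proof (intro conjI ballI allI)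
  show "1 \<in> {p. \<forall>i. value_at_least \<nu> (M i) (coeff p i)}"
    using assms(2) S_valuation_one[OF assms(1)] by (auto simp: value_at_least_def coeff_1)
next
  fix p q
  assume p: "p \<in> {p. \<forall>i. value_at_least \<nu> (M i) (coeff p i)}"
  show "smult c p \<in> {p. \<forall>i. value_at_least \<nu> (M i) (coeff p i)}" for c
  proof -
    have "value_at_least \<nu> 0 c"
      using assms(1) by (auto simp: value_at_least_def S_valuation_def)
    with p show ?thesis
      using value_at_least_mult[OF assms(1), of 0 c] by fastforce
  qed
  assume q: "q \<in> {p. \<forall>i. value_at_least \<nu> (M i) (coeff p i)}"
  from p q show "p + q \<in> {p. \<forall>i. value_at_least \<nu> (M i) (coeff p i)}"
    using value_at_least_add[OF assms(1)] by simp
  have "value_at_least \<nu> (M i) (coeff p l * coeff q (i - l))" if "l \<le> i" for i l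
  proof (rule value_at_least_antimono)
    show "value_at_least \<nu> (M l + M (i - l)) (coeff p l * coeff q (i - l))"
      using p q by (intro value_at_least_mult[OF assms(1)]) auto
    show "M i \<le> M l + M (i - l)" using assms(3)[of l "i - l"] that by simp
  qed
  then show "p * q \<in> {p. \<forall>i. value_at_least \<nu> (M i) (coeff p i)}"
    by (auto simp: coeff_mult intro!: value_at_least_sum[OF assms(1)])
qed

section \<open>Values of the ideals of a graded family\<close>

lemma zero_in_graded_family:
  assumes "graded_family I"
  shows "0 \<in> I i"
  using assms module.subspace_0[OF module_times]
  by (cases "i = 0") (auto simp: graded_family_def Suc_le_eq)

text \<open>Moves questions about \<open>I s\<close> into the algebra, where the generators are
  given.\<close>

lemma monom_in_rees_algebra_iff:
  assumes "graded_family I"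
  shows "monom x s \<in> rees_algebra I \<longleftrightarrow> x \<in> I s"
  using zero_in_graded_family[OF assms] by (auto simp: rees_algebra_def)

text \<open>That \<open>d\<close> is a minimum over generators of equal degree enters in two halves:
  attainment yields elements of small value, the bound yields the lower estimate.\<close>

lemma ideal_val_eq_Min_decomposition_sums:
  fixes I :: "nat \<Rightarrow> 'a::idom set"
  assumes "graded_family I" "S_valuation \<nu>"
    and f: "\<And>j. j \<in> J \<Longrightarrow> f j \<noteq> 0"
    and "rees_algebra I = poly_subalgebra hull ((\<lambda>j. monom (f j) (n j)) ` J)"
    and U: "finite U" "0 \<notin> U" "1 \<in> U"
    and d_le: "\<And>j. j \<in> J \<Longrightarrow> n j \<in> U \<and> d (n j) \<le> \<nu> (to_fract (f j))"
    and d_attained: "\<And>i. i \<in> U \<Longrightarrow> \<exists>j\<in>J. n j = i \<and> d i = \<nu> (to_fract (f j))"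
  shows "ideal_val \<nu> (I s) = Min (decomposition_sums U d s)"
proof -
  define M where "M s = Min (decomposition_sums U d s)" for s
  have M_le: "M s \<le> v" if "v \<in> decomposition_sums U d s" for s v
    unfolding M_def using finite_decomposition_sums[OF U(1,2)] that by simp
  have M_in: "M s \<in> decomposition_sums U d s" for s
    unfolding M_def using finite_decomposition_sums[OF U(1,2)] decomposition_sums_nonempty[OF U(3)]
    by (rule Min_in)
  have subalg: "poly_subalgebra (rees_algebra I)"
    unfolding assms(4) by (rule poly_subalgebra_hull)
  have gen: "monom (f j) (n j) \<in> rees_algebra I" if "j \<in> J" for j
    unfolding assms(4) using that by (blast intro: hull_inc)
  \<comment> \<open>Multiply generators of least value, one for each entry; values add up and the
    product stays nonzero. The empty product 1 lies in \<open>I 0\<close>, the whole ring.\<close>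
  have reach: "\<exists>x. x \<noteq> 0 \<and> x \<in> I (sum_list as) \<and> \<nu> (to_fract x) = (\<Sum>a\<leftarrow>as. d a)"
    if "set as \<subseteq> U" for as
    using that
  proof (induction as)
    case Nil
    show ?case
      using assms(1) S_valuation_one[OF assms(2)]
      by (intro exI[of _ 1]) (simp add: graded_family_def)
  next
    case (Cons a as)
    then obtain x where x: "x \<noteq> 0" "x \<in> I (sum_list as)" "\<nu> (to_fract x) = (\<Sum>a\<leftarrow>as. d a)"
      by auto
    from Cons.prems d_attained[of a] obtain j
      where j: "j \<in> J" "n j = a" "d a = \<nu> (to_fract (f j))" by auto
    have "monom (f j) (n j) * monom x (sum_list as) \<in> rees_algebra I"
      using subalg gen[OF j(1)] x(2) monom_in_rees_algebra_iff[OF assms(1)]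
      unfolding poly_subalgebra_def by blast
    then have "f j * x \<in> I (sum_list (a # as))"
      using j(2) by (simp add: mult_monom monom_in_rees_algebra_iff[OF assms(1)])
    moreover have "\<nu> (to_fract (f j * x)) = (\<Sum>a\<leftarrow>a # as. d a)"
      using S_valuation_mult[OF assms(2) f[OF j(1)] x(1)] x(3) j(3) by simp
    ultimately show ?case using f[OF j(1)] x(1) by (intro exI[of _ "f j * x"]) simp
  qed
  from M_in[of s] obtain as where "set as \<subseteq> U" "sum_list as = s" "M s = (\<Sum>a\<leftarrow>as. d a)"
    unfolding decomposition_sums_def by blast
  with reach obtain x where x: "x \<noteq> 0" "x \<in> I s" "\<nu> (to_fract x) = M s" by metis
  have "poly_subalgebra {p. \<forall>i. value_at_least \<nu> (M i) (coeff p i)}"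
  proof (rule poly_subalgebra_value_at_least[OF assms(2)])
    show "M 0 \<le> 0"
      by (rule M_le) (auto simp: decomposition_sums_def intro!: exI[of _ "[]"])
    show "M (i + j) \<le> M i + M j" for i j
      by (intro M_le add_in_decomposition_sums M_in)
  qed
  \<comment> \<open>In degree \<open>n j\<close> the value is at least \<open>d (n j)\<close>, which
    is one of the sums; in all other degrees the coefficient is 0.\<close>
  moreover have "value_at_least \<nu> (M i) (coeff (monom (f j) (n j)) i)" if "j \<in> J" for i j
    using d_le[OF that] M_le[OF generator_in_decomposition_sums[of "n j" U d]]
    by (auto simp: value_at_least_def)
  ultimately have "rees_algebra I \<subseteq> {p. \<forall>i. value_at_least \<nu> (M i) (coeff p i)}"
    unfolding assms(4) by (intro hull_minimal) auto
  then have lower: "value_at_least \<nu> (M s) y" if "y \<in> I s" for y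
  proof -
    from that have "monom y s \<in> rees_algebra I"
      by (simp only: monom_in_rees_algebra_iff[OF assms(1)])
    with \<open>rees_algebra I \<subseteq> _\<close> have "value_at_least \<nu> (M s) (coeff (monom y s) s)" by blast
    then show ?thesis by simp
  qed
  have "ideal_val \<nu> (I s) = M s"
    unfolding ideal_val_def
  \<comment> \<open>The integers are not well-ordered, so \<open>LEAST\<close> is identified by an
    attained lower bound.\<close>
  proof (rule Least_equality)
    show "M s \<in> (\<lambda>x. \<nu> (to_fract x)) ` (I s - {0})" using x by force
    show "M s \<le> v" if "v \<in> (\<lambda>x. \<nu> (to_fract x)) ` (I s - {0})" for v
      using that lower by (auto simp: value_at_least_def)
  qed
  then show ?thesis unfolding M_def .
qed

theorem theorem5p2:
  fixes G :: "nat \<Rightarrow> 'a::idom set"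
    and I :: "nat \<Rightarrow> 'a set"
    and \<nu> :: "'a fract \<Rightarrow> int"
    and k :: nat and f :: "nat \<Rightarrow> 'a" and n :: "nat \<Rightarrow> nat"
    and U :: "nat set" and d :: "nat \<Rightarrow> int"
  assumes "noetherian TYPE('a)"
    and "is_grading G"
    and "graded_family I"
    and "\<And>i. i \<ge> 1 \<Longrightarrow> homogeneous_ideal G (I i)"
    and "S_valuation \<nu>"
    and "\<And>j. j \<in> {1..k} \<Longrightarrow> f j \<noteq> 0 \<and> homogeneous G (f j)"
    and "\<And>j. j \<in> {1..k} \<Longrightarrow> n j \<ge> 1"
    and "rees_algebra I = poly_subalgebra hull ((\<lambda>j. monom (f j) (n j)) ` {1..k})"
    and "U = n ` {1..k}"
    and "1 \<in> U"
    and "\<And>i. i \<in> U \<Longrightarrow> d i = Min {\<nu> (to_fract (f j)) | j. j \<in> {1..k} \<and> n j = i}"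
  shows
    "(\<forall>s\<ge>1. ideal_val \<nu> (I s) =
        Min {(\<Sum>i\<in>U. d i * int (b i)) | b :: nat \<Rightarrow> nat. (\<Sum>i\<in>U. i * b i) = s}) \<and>
     (\<forall>s\<in>U. ideal_val \<nu> (I s) = d s \<longleftrightarrow> subadditive_term U d s) \<and>
     convergent (\<lambda>s. real_of_int (ideal_val \<nu> (I s)) / real s) \<and>
     asymptotic_val \<nu> I = Min {real_of_int (d i) / real i | i. i \<in> U} \<and>
     asymptotic_val \<nu> I =
        Min {real_of_int (d i) / real i | i. i \<in> U \<and> strictly_subadditive_term U d i}"
proof -
  have U: "finite U" "0 \<notin> U" "1 \<in> U"
    using assms(7,9,10) by fastforce+
  \<comment> \<open>As the image of a finite index set, the set of values is visibly finite, as
    \<open>Min\<close> requires.\<close>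
  have value_set: "{\<nu> (to_fract (f j)) | j. j \<in> {1..k} \<and> n j = i} =
      (\<lambda>j. \<nu> (to_fract (f j))) ` {j \<in> {1..k}. n j = i}" for i
    by blast
  have d: "d i = Min ((\<lambda>j. \<nu> (to_fract (f j))) ` {j \<in> {1..k}. n j = i})" if "i \<in> U" for i
    using assms(11)[OF that] unfolding value_set .
  have d_le: "n j \<in> U \<and> d (n j) \<le> \<nu> (to_fract (f j))" if "j \<in> {1..k}" for j
    using that d[of "n j"] assms(9) by simp
  have d_attained: "\<exists>j\<in>{1..k}. n j = i \<and> d i = \<nu> (to_fract (f j))" if "i \<in> U" for i
  proof -
    have "d i \<in> (\<lambda>j. \<nu> (to_fract (f j))) ` {j \<in> {1..k}. n j = i}"
      unfolding d[OF that] using that assms(9) by (intro Min_in) auto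
    then show ?thesis by blast
  qed
  have d_nonneg: "0 \<le> d i" if "i \<in> U" for i
    using d_attained[OF that] assms(5,6) by (auto simp: S_valuation_def)
  \<comment> \<open>Stated for every \<open>s\<close>, 0 included, so that the whole sequence can be
    rewritten below.\<close>
  have val: "ideal_val \<nu> (I s) = Min (decomposition_sums U d s)" for s
    using assms(3,5) _ assms(8) U d_le d_attained
    by (rule ideal_val_eq_Min_decomposition_sums) (use assms(6) in blast)+
  obtain i where i: "i \<in> U" "strictly_subadditive_term U d i"
    "\<And>j. j \<in> U \<Longrightarrow> real_of_int (d i) / real i \<le> real_of_int (d j) / real j"
    using minimal_slope_strictly_subadditive[of U d] U by blast
  have limit: "(\<lambda>s. real_of_int (ideal_val \<nu> (I s)) / real s) \<longlonglongrightarrow> real_of_int (d i) / real i"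
    unfolding val using U i(1) d_nonneg i(3) by (rule Min_decomposition_sums_slope_limit)
  then have asymp: "asymptotic_val \<nu> I = real_of_int (d i) / real i"
    unfolding asymptotic_val_def by (rule limI)
  \<comment> \<open>Both minima at once: on every part of \<open>U\<close> that contains
    \<open>i\<close>, the least slope is attained at \<open>i\<close>.\<close>
  have "Min {real_of_int (d j) / real j | j. j \<in> U \<and> P j} = real_of_int (d i) / real i"
    if "P i" for P
    using that U(1) i by (intro Min_eqI) auto
  from this[of "\<lambda>_. True"] this[of "strictly_subadditive_term U d", OF i(2)] show ?thesis
    using val Min_decomposition_sums_eq_iff_subadditive[OF U(1,2)] limit
    by (auto simp: asymp decomposition_sums_eq_multiplicities[OF U(1)] convergent_def)
qed

end
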